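(* Let $T$ be a distributive lattice and $\ell\ge0$. Consider the following universal problem: find a distributive lattice $K$ and $\ell+1$ homomorphisms $\varphi_0\ge\varphi_1\ge\cdots\ge\varphi_\ell$ from $T$ to $K$ such that, for any distributive lattice $T'$ and any homomorphisms $\psi_0\ge\psi_1\ge\cdots\ge\psi_\ell$ in $\mathrm{Hom}(T,T')$, there is one and only one homomorphism $\eta:K\to T'$ such that $\eta\varphi_0=\psi_0$, $\eta\varphi_1=\psi_1,\ldots,\eta\varphi_\ell=\psi_\ell$. This universal problem admits a unique solution (up to isomorphism), and the corresponding distributive lattice, written $\mathrm{Kr}_\ell(T)$, can be described as the lattice generated by the disjoint union $S$ of $\ell+1$ copies of $T$ (write $\varphi_i$ for the bijection between $T$ and the $i$-th copy) with the entailment relation $\vdash_S$ defined as follows. If $U_i$ and $J_i$ $(i=0,\ldots,\ell)$ are finite subsets of $T$, then $$\varphi_0(U_0),\ldots,\varphi_\ell(U_\ell)\;\vdash_S\;\varphi_0(J_0),\ldots,\varphi_\ell(J_\ell)$$ if and only if there exist $x_1,\ldots,x_\ell\in T$ such that, in $T$, $$\begin{array}{rcl} x_1,\;U_0&\vdash&J_0\\ x_2,\;U_1&\vdash&J_1,\;x_1\\ &\vdots&\\ x_\ell,\;U_{\ell-1}&\vdash&J_{\ell-1},\;x_{\ell-1}\\ U_\ell&\vdash&J_\ell,\;x_\ell \end{array}$$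
   Context: Distributive lattices have $0$ and $1$, and homomorphisms preserve $\wedge,\vee,0,1$. For homomorphisms $\varphi,\psi:T\to T'$, $\varphi\le\psi$ means $\varphi(x)\le\psi(x)$ for all $x\in T$. For finite subsets $A,B$ of $T$, $A\vdash B$ means $\bigwedge A\le\bigvee B$; $x$ stands for $\{x\}$ and commas stand for unions. An entailment relation on a set $S$ is a relation $\vdash_S$ between finite subsets of $S$ which is reflexive ($a\vdash_S a$), monotone ($A\vdash_S B$ implies $A,A'\vdash_S B,B'$) and transitive (if $A,x\vdash_S B$ and $A\vdash_S B,x$ then $A\vdash_S B$). The distributive lattice generated by $(S,\vdash_S)$ is the distributive lattice defined by the generators $s\in S$ and the relations $\bigwedge A\le\bigvee B$ for all finite $A,B\subseteq S$ with $A\vdash_S B$. *)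

theory Defs
  imports "HOL-Algebra.Lattice"
begin

locale bounded_distrib_lattice = bounded_lattice +
  assumes meet_join_distrib:
    "\<lbrakk>x \<in> carrier L; y \<in> carrier L; z \<in> carrier L\<rbrakk> \<Longrightarrow>
      x \<sqinter> (y \<squnion> z) = (x \<sqinter> y) \<squnion> (x \<sqinter> z)"

definition lattice_hom :: "'a gorder \<Rightarrow> 'b gorder \<Rightarrow> ('a \<Rightarrow> 'b) set" where
  "lattice_hom L M =
    {f \<in> carrier L \<rightarrow> carrier M.
      meet_pres L M f \<and> join_pres L M f \<and> f \<bottom>\<^bsub>L\<^esub> = \<bottom>\<^bsub>M\<^esub> \<and> f \<top>\<^bsub>L\<^esub> = \<top>\<^bsub>M\<^esub>}"

definition lattice_iso :: "'a gorder \<Rightarrow> 'b gorder \<Rightarrow> ('a \<Rightarrow> 'b) set" where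
  "lattice_iso L M = {f \<in> lattice_hom L M. bij_betw f (carrier L) (carrier M)}"

definition hom_le :: "'a gorder \<Rightarrow> 'b gorder \<Rightarrow> ('a \<Rightarrow> 'b) \<Rightarrow> ('a \<Rightarrow> 'b) \<Rightarrow> bool" where
  "hom_le L M f g \<longleftrightarrow> (\<forall>x\<in>carrier L. f x \<sqsubseteq>\<^bsub>M\<^esub> g x)"

text \<open>For finite subsets of the carrier. In a bounded lattice the empty infimum is the top
  and the empty supremum is the bottom element.\<close>

definition lat_entails :: "'a gorder \<Rightarrow> 'a set \<Rightarrow> 'a set \<Rightarrow> bool" where
  "lat_entails L A B \<longleftrightarrow> \<Sqinter>\<^bsub>L\<^esub> A \<sqsubseteq>\<^bsub>L\<^esub> \<Squnion>\<^bsub>L\<^esub> B"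

definition entailment_relation :: "'s set \<Rightarrow> ('s set \<Rightarrow> 's set \<Rightarrow> bool) \<Rightarrow> bool" where
  "entailment_relation S E \<longleftrightarrow>
    (\<forall>A B. E A B \<longrightarrow> finite A \<and> A \<subseteq> S \<and> finite B \<and> B \<subseteq> S) \<and>
    (\<forall>a\<in>S. E {a} {a}) \<and>
    (\<forall>A A' B B'. finite A' \<and> A' \<subseteq> S \<and> finite B' \<and> B' \<subseteq> S \<and> E A B
      \<longrightarrow> E (A \<union> A') (B \<union> B')) \<and>
    (\<forall>A B. \<forall>x\<in>S. finite A \<and> A \<subseteq> S \<and> finite B \<and> B \<subseteq> S \<and>
      E (A \<union> {x}) B \<and> E A (B \<union> {x}) \<longrightarrow> E A B)"

datatype 's lat_term =
  Gen 's | Bot | Top | Meet "'s lat_term" "'s lat_term" | Join "'s lat_term" "'s lat_term"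

definition terms_over :: "'s set \<Rightarrow> 's lat_term set" where
  "terms_over S = {t. set_lat_term t \<subseteq> S}"

definition Meets :: "'s list \<Rightarrow> 's lat_term" where
  "Meets xs = foldr (\<lambda>x t. Meet (Gen x) t) xs Top"

definition Joins :: "'s list \<Rightarrow> 's lat_term" where
  "Joins xs = foldr (\<lambda>x t. Join (Gen x) t) xs Bot"

text \<open>The least preorder on the terms over \<open>S\<close> whose quotient is a bounded distributive
  lattice satisfying the relations. Lists enumerate the finite subsets of \<open>S\<close>; the rule
  \<open>rel\<close> is imposed for every enumeration.\<close>

inductive term_le :: "'s set \<Rightarrow> ('s set \<Rightarrow> 's set \<Rightarrow> bool) \<Rightarrow> 's lat_term \<Rightarrow> 's lat_term \<Rightarrow> bool"
  for S :: "'s set" and E :: "'s set \<Rightarrow> 's set \<Rightarrow> bool"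
where
  refl: "t \<in> terms_over S \<Longrightarrow> term_le S E t t"
| trans: "term_le S E t u \<Longrightarrow> term_le S E u v \<Longrightarrow> term_le S E t v"
| bot: "t \<in> terms_over S \<Longrightarrow> term_le S E Bot t"
| top: "t \<in> terms_over S \<Longrightarrow> term_le S E t Top"
| meet1: "t \<in> terms_over S \<Longrightarrow> u \<in> terms_over S \<Longrightarrow> term_le S E (Meet t u) t"
| meet2: "t \<in> terms_over S \<Longrightarrow> u \<in> terms_over S \<Longrightarrow> term_le S E (Meet t u) u"
| meet: "term_le S E v t \<Longrightarrow> term_le S E v u \<Longrightarrow> term_le S E v (Meet t u)"
| join1: "t \<in> terms_over S \<Longrightarrow> u \<in> terms_over S \<Longrightarrow> term_le S E t (Join t u)"
| join2: "t \<in> terms_over S \<Longrightarrow> u \<in> terms_over S \<Longrightarrow> term_le S E u (Join t u)"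
| join: "term_le S E t v \<Longrightarrow> term_le S E u v \<Longrightarrow> term_le S E (Join t u) v"
| distrib: "t \<in> terms_over S \<Longrightarrow> u \<in> terms_over S \<Longrightarrow> v \<in> terms_over S \<Longrightarrow>
    term_le S E (Meet t (Join u v)) (Join (Meet t u) (Meet t v))"
| rel: "set xs \<subseteq> S \<Longrightarrow> set ys \<subseteq> S \<Longrightarrow> E (set xs) (set ys) \<Longrightarrow> term_le S E (Meets xs) (Joins ys)"

definition term_class :: "'s set \<Rightarrow> ('s set \<Rightarrow> 's set \<Rightarrow> bool) \<Rightarrow> 's lat_term \<Rightarrow> 's lat_term set" where
  "term_class S E t = {u \<in> terms_over S. term_le S E t u \<and> term_le S E u t}"

definition generated_lattice :: "'s set \<Rightarrow> ('s set \<Rightarrow> 's set \<Rightarrow> bool) \<Rightarrow> 's lat_term set gorder" where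
  "generated_lattice S E =
    \<lparr> carrier = term_class S E ` terms_over S,
      eq = (=),
      le = (\<lambda>X Y. \<exists>t\<in>X. \<exists>u\<in>Y. term_le S E t u) \<rparr>"

definition hom_chain :: "nat \<Rightarrow> 'a gorder \<Rightarrow> 'b gorder \<Rightarrow> (nat \<Rightarrow> 'a \<Rightarrow> 'b) \<Rightarrow> bool" where
  "hom_chain l T K \<phi> \<longleftrightarrow>
    (\<forall>i\<le>l. \<phi> i \<in> lattice_hom T K) \<and> (\<forall>i<l. hom_le T K (\<phi> (Suc i)) (\<phi> i))"

text \<open>The first argument fixes the type over which the test lattices \<open>T'\<close> range, since HOL
  cannot quantify over types inside a formula. Maps out of \<open>K\<close> are made extensional so that
  uniqueness means uniqueness on \<open>carrier K\<close>.\<close>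

definition universal_chain ::
  "'c itself \<Rightarrow> nat \<Rightarrow> 'a gorder \<Rightarrow> 'b gorder \<Rightarrow> (nat \<Rightarrow> 'a \<Rightarrow> 'b) \<Rightarrow> bool" where
  "universal_chain _ l T K \<phi> \<longleftrightarrow>
    bounded_distrib_lattice K \<and> hom_chain l T K \<phi> \<and>
    (\<forall>(T' :: 'c gorder) \<psi>. bounded_distrib_lattice T' \<and> hom_chain l T T' \<psi> \<longrightarrow>
      (\<exists>!\<eta>. \<eta> \<in> lattice_hom K T' \<and> \<eta> \<in> extensional (carrier K) \<and>
        (\<forall>i\<le>l. \<forall>x\<in>carrier T. \<eta> (\<phi> i x) = \<psi> i x)))"

definition kr_gens :: "nat \<Rightarrow> 'a gorder \<Rightarrow> (nat \<times> 'a) set" where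
  "kr_gens l T = {..l} \<times> carrier T"

text \<open>The first line of the system has no \<open>x\<close> on the right, the last one no \<open>x\<close> on the left;
  for \<open>l = 0\<close> it is the single condition that \<open>U 0\<close> entails \<open>J 0\<close>.\<close>

definition kr_system ::
  "nat \<Rightarrow> 'a gorder \<Rightarrow> (nat \<Rightarrow> 'a set) \<Rightarrow> (nat \<Rightarrow> 'a set) \<Rightarrow> (nat \<Rightarrow> 'a) \<Rightarrow> bool" where
  "kr_system l T U J x \<longleftrightarrow>
    (\<forall>i\<le>l. lat_entails T
      ((if i < l then {x (Suc i)} else {}) \<union> U i)
      (J i \<union> (if 0 < i then {x i} else {})))"

text \<open>\<open>A `` {i}\<close> is the part of \<open>A\<close> lying in the \<open>i\<close>-th copy of \<open>T\<close>.\<close>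

definition kr_entails :: "nat \<Rightarrow> 'a gorder \<Rightarrow> (nat \<times> 'a) set \<Rightarrow> (nat \<times> 'a) set \<Rightarrow> bool" where
  "kr_entails l T A B \<longleftrightarrow>
    finite A \<and> A \<subseteq> kr_gens l T \<and> finite B \<and> B \<subseteq> kr_gens l T \<and>
    (\<exists>x. (\<forall>i\<in>{1..l}. x i \<in> carrier T) \<and>
      kr_system l T (\<lambda>i. A `` {i}) (\<lambda>i. B `` {i}) x)"

lemma kr_entails_iff:
  assumes "\<And>i. i \<le> l \<Longrightarrow> finite (U i) \<and> U i \<subseteq> carrier T"
    and "\<And>i. i \<le> l \<Longrightarrow> finite (J i) \<and> J i \<subseteq> carrier T"
  shows "kr_entails l T (\<Union>i\<le>l. Pair i ` U i) (\<Union>i\<le>l. Pair i ` J i) \<longleftrightarrow>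
    (\<exists>x. (\<forall>i\<in>{1..l}. x i \<in> carrier T) \<and> kr_system l T U J x)"
proof -
  have *: "(\<Union>i\<le>l. Pair i ` V i) `` {i} = V i" if "i \<le> l" for i and V :: "nat \<Rightarrow> 'a set"
    using that by auto
  have "finite (\<Union>i\<le>l. Pair i ` U i)" "finite (\<Union>i\<le>l. Pair i ` J i)"
    using assms by auto
  moreover have "(\<Union>i\<le>l. Pair i ` U i) \<subseteq> kr_gens l T" "(\<Union>i\<le>l. Pair i ` J i) \<subseteq> kr_gens l T"
    using assms by (force simp: kr_gens_def)+
  ultimately show ?thesis
    by (simp add: kr_entails_def kr_system_def * cong: conj_cong)
qed

definition Kr :: "nat \<Rightarrow> 'a gorder \<Rightarrow> (nat \<times> 'a) lat_term set gorder" where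
  "Kr l T = generated_lattice (kr_gens l T) (kr_entails l T)"

definition kr_map :: "nat \<Rightarrow> 'a gorder \<Rightarrow> nat \<Rightarrow> 'a \<Rightarrow> (nat \<times> 'a) lat_term set" where
  "kr_map l T i x = term_class (kr_gens l T) (kr_entails l T) (Gen (i, x))"

end

theory Submission
  imports Defs
begin

text \<open>
  Put \<open>x\<^sub>0 = 0\<close> and \<open>x\<^bsub>l+1\<^esub> = 1\<close>; the system then reads
  \<open>x\<^bsub>i+1\<^esub> \<sqinter> \<Sqinter>U\<^sub>i \<le> \<Squnion>J\<^sub>i \<squnion> x\<^sub>i\<close> for all \<open>i \<le> l\<close>. Transitivity of the
  relation, with cut element in the \<open>k\<close>-th copy, holds because two solutions \<open>x\<close> and \<open>y\<close> of
  the premises combine to the solution \<open>x\<^sub>i \<squnion> y\<^sub>i\<close> for \<open>i \<le> k\<close> and \<open>x\<^sub>i \<sqinter> y\<^sub>i\<close> for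
  \<open>i > k\<close>. Solutions taking only the values \<open>0\<close>, \<open>1\<close> and possibly one further element show
  that the canonical maps form a decreasing chain of homomorphisms. Conversely a chain
  \<open>\<psi>\<^sub>0 \<ge> \<dots> \<ge> \<psi>\<^sub>l\<close> sends every entailment to a true inequality: writing \<open>p\<close> and \<open>q\<close> for the
  meet and the join of the images, \<open>p \<sqinter> \<psi>\<^sub>i x\<^bsub>i+1\<^esub> \<le> q\<close> follows by induction on \<open>i\<close>, and
  \<open>i = l\<close> gives \<open>p \<le> q\<close>. The universal property is therefore that of the lattice presented by
  generators and relations.
\<close>

section \<open>Finite meets and joins in bounded distributive lattices\<close>

context bounded_distrib_lattice
begin

text \<open>Includes the empty set: every element of the carrier is then a lower bound, and the
  greatest one exists because the lattice is bounded. All later facts on finite infima can thus be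
  stated without a nonemptiness assumption.\<close>

lemma finite_inf_greatest_Lower:
  assumes "finite A" "A \<subseteq> carrier L"
  shows "greatest L (\<Sqinter>A) (Lower L A)"
proof (cases "A = {}")
  case True
  then show ?thesis
    using someI_ex[OF top_exists] by (simp add: Lattice.inf_def)
qed (use assms finite_inf_greatest in auto)

lemma finite_sup_least_Upper:
  assumes "finite A" "A \<subseteq> carrier L"
  shows "least L (\<Squnion>A) (Upper L A)"
proof (cases "A = {}")
  case True
  then show ?thesis
    using someI_ex[OF bottom_exists] by (simp add: Lattice.sup_def)
qed (use assms finite_sup_least in auto)

lemma inf_closed [simp]: "finite A \<Longrightarrow> A \<subseteq> carrier L \<Longrightarrow> \<Sqinter>A \<in> carrier L"
  using finite_inf_greatest_Lower by blast

lemma sup_closed [simp]: "finite A \<Longrightarrow> A \<subseteq> carrier L \<Longrightarrow> \<Squnion>A \<in> carrier L"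
  using finite_sup_least_Upper by blast

lemma inf_lower: "finite A \<Longrightarrow> A \<subseteq> carrier L \<Longrightarrow> a \<in> A \<Longrightarrow> \<Sqinter>A \<sqsubseteq> a"
  using finite_inf_greatest_Lower greatest_Lower_below by metis

lemma sup_upper: "finite A \<Longrightarrow> A \<subseteq> carrier L \<Longrightarrow> a \<in> A \<Longrightarrow> a \<sqsubseteq> \<Squnion>A"
  using finite_sup_least_Upper least_Upper_above by metis

lemma le_inf:
  "finite A \<Longrightarrow> A \<subseteq> carrier L \<Longrightarrow> y \<in> carrier L \<Longrightarrow> (\<And>a. a \<in> A \<Longrightarrow> y \<sqsubseteq> a) \<Longrightarrow> y \<sqsubseteq> \<Sqinter>A"
  by (rule greatest_le[OF finite_inf_greatest_Lower]) (auto intro: Lower_memI)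

lemma sup_le:
  "finite A \<Longrightarrow> A \<subseteq> carrier L \<Longrightarrow> y \<in> carrier L \<Longrightarrow> (\<And>a. a \<in> A \<Longrightarrow> a \<sqsubseteq> y) \<Longrightarrow> \<Squnion>A \<sqsubseteq> y"
  by (rule least_le[OF finite_sup_least_Upper]) (auto intro: Upper_memI)

lemma inf_antimono:
  "finite B \<Longrightarrow> B \<subseteq> carrier L \<Longrightarrow> A \<subseteq> B \<Longrightarrow> \<Sqinter>B \<sqsubseteq> \<Sqinter>A"
  by (rule le_inf) (auto intro: inf_lower finite_subset)

lemma sup_mono:
  "finite B \<Longrightarrow> B \<subseteq> carrier L \<Longrightarrow> A \<subseteq> B \<Longrightarrow> \<Squnion>A \<sqsubseteq> \<Squnion>B"
  by (rule sup_le) (auto intro: sup_upper finite_subset)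

section \<open>Order rules for binary meets and joins, and their relation to finite infima and
  suprema\<close>

lemma le_meet_iff:
  "x \<in> carrier L \<Longrightarrow> y \<in> carrier L \<Longrightarrow> z \<in> carrier L \<Longrightarrow> z \<sqsubseteq> x \<sqinter> y \<longleftrightarrow> z \<sqsubseteq> x \<and> z \<sqsubseteq> y"
  by (meson le_trans meet_closed meet_le meet_left meet_right)

lemma join_le_iff:
  "x \<in> carrier L \<Longrightarrow> y \<in> carrier L \<Longrightarrow> z \<in> carrier L \<Longrightarrow> x \<squnion> y \<sqsubseteq> z \<longleftrightarrow> x \<sqsubseteq> z \<and> y \<sqsubseteq> z"
  by (meson le_trans join_closed join_le join_left join_right)

lemma meet_leI1:
  "x \<sqsubseteq> z \<Longrightarrow> x \<in> carrier L \<Longrightarrow> y \<in> carrier L \<Longrightarrow> z \<in> carrier L \<Longrightarrow> x \<sqinter> y \<sqsubseteq> z"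
  by (meson le_trans meet_closed meet_left)

lemma meet_leI2:
  "y \<sqsubseteq> z \<Longrightarrow> x \<in> carrier L \<Longrightarrow> y \<in> carrier L \<Longrightarrow> z \<in> carrier L \<Longrightarrow> x \<sqinter> y \<sqsubseteq> z"
  by (meson le_trans meet_closed meet_right)

lemma le_joinI1:
  "z \<sqsubseteq> x \<Longrightarrow> x \<in> carrier L \<Longrightarrow> y \<in> carrier L \<Longrightarrow> z \<in> carrier L \<Longrightarrow> z \<sqsubseteq> x \<squnion> y"
  by (meson le_trans join_closed join_left)

lemma le_joinI2:
  "z \<sqsubseteq> y \<Longrightarrow> x \<in> carrier L \<Longrightarrow> y \<in> carrier L \<Longrightarrow> z \<in> carrier L \<Longrightarrow> z \<sqsubseteq> x \<squnion> y"
  by (meson le_trans join_closed join_right)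

lemma inf_insert:
  assumes "finite A" "A \<subseteq> carrier L" "x \<in> carrier L"
  shows "\<Sqinter>(insert x A) = x \<sqinter> \<Sqinter>A"
proof (rule le_antisym)
  show "\<Sqinter>(insert x A) \<sqsubseteq> x \<sqinter> \<Sqinter>A"
    using assms by (intro meet_le inf_lower inf_antimono) auto
  show "x \<sqinter> \<Sqinter>A \<sqsubseteq> \<Sqinter>(insert x A)"
    using assms by (intro le_inf) (auto intro: meet_leI1 meet_leI2 inf_lower)
qed (use assms in auto)

lemma sup_insert:
  assumes "finite A" "A \<subseteq> carrier L" "x \<in> carrier L"
  shows "\<Squnion>(insert x A) = x \<squnion> \<Squnion>A"
proof (rule le_antisym)
  show "x \<squnion> \<Squnion>A \<sqsubseteq> \<Squnion>(insert x A)"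
    using assms by (intro join_le sup_upper sup_mono) auto
  show "\<Squnion>(insert x A) \<sqsubseteq> x \<squnion> \<Squnion>A"
    using assms by (intro sup_le) (auto intro: le_joinI1 le_joinI2 sup_upper)
qed (use assms in auto)

lemma inf_empty [simp]: "\<Sqinter>{} = \<top>"
  by (rule top_eq) (auto intro: le_inf)

lemma sup_empty [simp]: "\<Squnion>{} = \<bottom>"
  by (rule bottom_eq) (auto intro: sup_le)

lemma inf_singleton [simp]: "x \<in> carrier L \<Longrightarrow> \<Sqinter>{x} = x"
  by (rule le_antisym) (auto intro: le_inf inf_lower)

lemma sup_singleton [simp]: "x \<in> carrier L \<Longrightarrow> \<Squnion>{x} = x"
  by (rule le_antisym) (auto intro: sup_le sup_upper)

lemma meet_top_eq [simp]: "x \<in> carrier L \<Longrightarrow> \<top> \<sqinter> x = x" "x \<in> carrier L \<Longrightarrow> x \<sqinter> \<top> = x"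
  using top_meet eq_is_equal by (simp_all add: meet_comm[of _ x])

lemma join_bottom_eq [simp]: "x \<in> carrier L \<Longrightarrow> \<bottom> \<squnion> x = x" "x \<in> carrier L \<Longrightarrow> x \<squnion> \<bottom> = x"
  using bottom_join eq_is_equal by (simp_all add: join_comm[of _ x])

text \<open>Distributivity in the form of a cut rule: \<open>p\<close> lies below the meet of
  \<open>p\<close> with \<open>q \<squnion> z\<close>, and both parts of the distributed meet lie
  below \<open>q\<close>.\<close>

lemma cut:
  assumes "p \<sqinter> z \<sqsubseteq> q" "p \<sqsubseteq> q \<squnion> z" "p \<in> carrier L" "q \<in> carrier L" "z \<in> carrier L"
  shows "p \<sqsubseteq> q"
proof -
  have "p \<sqsubseteq> p \<sqinter> (q \<squnion> z)"
    using assms by (simp add: le_meet_iff)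
  also have "p \<sqinter> (q \<squnion> z) = (p \<sqinter> q) \<squnion> (p \<sqinter> z)"
    using assms by (simp add: meet_join_distrib)
  finally have "p \<sqsubseteq> (p \<sqinter> q) \<squnion> (p \<sqinter> z)" .
  moreover have "(p \<sqinter> q) \<squnion> (p \<sqinter> z) \<sqsubseteq> q"
    using assms by (simp add: join_le_iff meet_right)
  ultimately show ?thesis
    using assms by (meson join_closed meet_closed le_trans)
qed

lemma join_meet_le:
  assumes "x \<sqinter> u \<sqsubseteq> q" "y \<sqinter> u \<sqsubseteq> q"
    and "x \<in> carrier L" "y \<in> carrier L" "u \<in> carrier L" "q \<in> carrier L"
  shows "(x \<squnion> y) \<sqinter> u \<sqsubseteq> q"
  using assms by (simp add: meet_comm[of _ _ u] meet_join_distrib join_le_iff)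

text \<open>The dual distributive law as an inequality, obtained from two nested cuts: on
  \<open>x\<close>, and then on \<open>y\<close> once \<open>x\<close> has been added on the
  left.\<close>

lemma le_join_meet:
  assumes "p \<sqsubseteq> j \<squnion> x" "p \<sqsubseteq> j \<squnion> y"
    and "x \<in> carrier L" "y \<in> carrier L" "j \<in> carrier L" "p \<in> carrier L"
  shows "p \<sqsubseteq> j \<squnion> (x \<sqinter> y)"
proof (rule cut[of _ x])
  show "p \<sqinter> x \<sqsubseteq> j \<squnion> (x \<sqinter> y)"
  proof (rule cut[of _ y])
    show "(p \<sqinter> x) \<sqinter> y \<sqsubseteq> j \<squnion> (x \<sqinter> y)"
      using assms by (intro le_joinI2) (simp_all add: le_meet_iff meet_leI1 meet_leI2)
    have "p \<sqsubseteq> (j \<squnion> (x \<sqinter> y)) \<squnion> y"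
      using assms by (intro le_trans[OF assms(2)]) (simp_all add: join_le_iff le_joinI1 le_joinI2)
    then show "p \<sqinter> x \<sqsubseteq> (j \<squnion> (x \<sqinter> y)) \<squnion> y"
      using assms by (intro meet_leI1) auto
  qed (use assms in auto)
  show "p \<sqsubseteq> (j \<squnion> (x \<sqinter> y)) \<squnion> x"
    using assms by (intro le_trans[OF assms(1)]) (simp_all add: join_le_iff le_joinI1 le_joinI2)
qed (use assms in auto)

end

section \<open>The entailment relation\<close>

context
  fixes T :: "'a gorder" (structure)
  assumes T: "bounded_distrib_lattice T"
begin

interpretation bounded_distrib_lattice T
  by (rule T)

text \<open>Padding the solution by bottom at 0 and top at \<open>Suc l\<close> adds only neutral
  elements to the first and last lines, so all lines get one uniform shape and no case distinction
  on the index is needed later.\<close>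

lemma kr_entails_cases:
  assumes "finite A" "A \<subseteq> kr_gens l T" "finite B" "B \<subseteq> kr_gens l T"
  shows "kr_entails l T A B \<longleftrightarrow>
    (\<exists>x. x 0 = \<bottom> \<and> x (Suc l) = \<top> \<and> (\<forall>i. x i \<in> carrier T) \<and>
      (\<forall>i\<le>l. x (Suc i) \<sqinter> \<Sqinter>(A `` {i}) \<sqsubseteq> \<Squnion>(B `` {i}) \<squnion> x i))"
    (is "_ \<longleftrightarrow> (\<exists>x. ?P x)")
proof -
  have fin: "finite (A `` {i})" "A `` {i} \<subseteq> carrier T" "finite (B `` {i})" "B `` {i} \<subseteq> carrier T" for i
    using assms by (auto simp: kr_gens_def)
  \<comment> \<open>Here \<open>x\<close> is a raw solution, constrained only at the indices from 1
    to \<open>l\<close>, and \<open>y\<close> its padded form. The converse direction below takes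
    \<open>y = x\<close>.\<close>
  have *: "lat_entails T ((if i < l then {x (Suc i)} else {}) \<union> A `` {i})
      (B `` {i} \<union> (if 0 < i then {x i} else {})) \<longleftrightarrow>
      y (Suc i) \<sqinter> \<Sqinter>(A `` {i}) \<sqsubseteq> \<Squnion>(B `` {i}) \<squnion> y i"
    if "i \<le> l" "\<forall>i\<in>{1..l}. x i \<in> carrier T \<and> y i = x i" "y 0 = \<bottom>" "y (Suc l) = \<top>" for i x y
  proof -
    have "\<Sqinter>((if i < l then {x (Suc i)} else {}) \<union> A `` {i}) = y (Suc i) \<sqinter> \<Sqinter>(A `` {i})"
      using that fin[of i] by (cases "i = l") (auto simp: inf_insert)
    moreover have "\<Squnion>(B `` {i} \<union> (if 0 < i then {x i} else {})) = \<Squnion>(B `` {i}) \<squnion> y i"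
      using that fin[of i] by (cases "i = 0") (auto simp: sup_insert join_comm)
    ultimately show ?thesis
      by (simp add: lat_entails_def)
  qed
  show ?thesis
  proof
    assume "kr_entails l T A B"
    then obtain x where x: "\<forall>i\<in>{1..l}. x i \<in> carrier T"
      "kr_system l T (\<lambda>i. A `` {i}) (\<lambda>i. B `` {i}) x"
      unfolding kr_entails_def by blast
    \<comment> \<open>All indices above \<open>l\<close> receive top, so that \<open>y\<close> lies
      in the carrier everywhere.\<close>
    define y where "y i = (if i = 0 then \<bottom> else if i \<le> l then x i else \<top>)" for i
    have "?P y"
      using x *[of _ x y] unfolding kr_system_def by (auto simp: y_def)
    then show "\<exists>x. ?P x"
      by blast
  next
    assume "\<exists>x. ?P x"
    then obtain x where x: "?P x" ..
    then have "kr_system l T (\<lambda>i. A `` {i}) (\<lambda>i. B `` {i}) x"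
      using *[of _ x x] unfolding kr_system_def by blast
    then show "kr_entails l T A B"
      using assms x unfolding kr_entails_def by blast
  qed
qed

text \<open>The solution jumps from bottom to top right after index \<open>i\<close>. Line
  \<open>i\<close> becomes the given entailment, the lines before it have bottom on the left and
  those after it have top on the right.\<close>

lemma kr_entails_Pair:
  assumes "i \<le> l" "finite U" "U \<subseteq> carrier T" "finite J" "J \<subseteq> carrier T" "lat_entails T U J"
  shows "kr_entails l T (Pair i ` U) (Pair i ` J)"
proof -
  have im: "(Pair i ` V) `` {k} = (if k = i then V else {})" for V :: "'a set" and k
    by auto
  show ?thesis
    using assms
    by (subst kr_entails_cases)
      (auto simp: kr_gens_def im lat_entails_def
        intro!: exI[of _ "\<lambda>k. if k \<le> i then \<bottom> else \<top>"])
qed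

text \<open>These entailments make the canonical chain decreasing. The solution passes from bottom
  to top through the single value \<open>a\<close> at \<open>Suc i\<close>: lines \<open>i\<close>
  and \<open>Suc i\<close> both reduce to \<open>a \<sqsubseteq> a\<close>, and the others are
  trivial as in \<open>kr_entails_Pair\<close>.\<close>

lemma kr_entails_Suc:
  assumes "i < l" "a \<in> carrier T"
  shows "kr_entails l T {(Suc i, a)} {(i, a)}"
proof -
  have im: "{(j, a)} `` {k} = (if k = j then {a} else {})" for j k
    by auto
  show ?thesis
    using assms
    by (subst kr_entails_cases)
      (auto simp: kr_gens_def im join_le_iff intro: meet_leI1 le_joinI1 le_joinI2
        intro!: exI[of _ "\<lambda>k. if k \<le> i then \<bottom> else if k = Suc i then a else \<top>"])
qed

lemma entailment_relation_kr_entails: "entailment_relation (kr_gens l T) (kr_entails l T)"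
  unfolding entailment_relation_def
proof (intro conjI allI impI ballI)
  fix A B
  assume "kr_entails l T A B"
  then show "finite A" "A \<subseteq> kr_gens l T" "finite B" "B \<subseteq> kr_gens l T"
    by (auto simp: kr_entails_def)
next
  fix a
  assume "a \<in> kr_gens l T"
  then show "kr_entails l T {a} {a}"
    using kr_entails_Pair[of "fst a" l "{snd a}" "{snd a}"]
    by (auto simp: kr_gens_def lat_entails_def)
next
  fix A A' B B'
  assume *: "finite A' \<and> A' \<subseteq> kr_gens l T \<and> finite B' \<and> B' \<subseteq> kr_gens l T \<and> kr_entails l T A B"
  then have fin: "finite A" "A \<subseteq> kr_gens l T" "finite B" "B \<subseteq> kr_gens l T"
    by (auto simp: kr_entails_def)
  have img: "finite (V `` {i})" "V `` {i} \<subseteq> carrier T"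
    if "finite V" "V \<subseteq> kr_gens l T" for V i
    using that by (auto simp: kr_gens_def)
  obtain x where x: "x 0 = \<bottom>" "x (Suc l) = \<top>" "\<And>i. x i \<in> carrier T"
    "\<And>i. i \<le> l \<Longrightarrow> x (Suc i) \<sqinter> \<Sqinter>(A `` {i}) \<sqsubseteq> \<Squnion>(B `` {i}) \<squnion> x i"
    using * kr_entails_cases[OF fin] by blast
  \<comment> \<open>The same \<open>x\<close> solves the enlarged system, since enlarging
    \<open>A\<close> lowers the infimum on the left and enlarging \<open>B\<close> raises the
    supremum on the right.\<close>
  have "x (Suc i) \<sqinter> \<Sqinter>((A \<union> A') `` {i}) \<sqsubseteq> \<Squnion>((B \<union> B') `` {i}) \<squnion> x i" if "i \<le> l" for i
  proof -
    have inf: "\<Sqinter>((A \<union> A') `` {i}) \<sqsubseteq> \<Sqinter>(A `` {i})"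
      using fin * by (intro inf_antimono img) auto
    have sup: "\<Squnion>(B `` {i}) \<sqsubseteq> \<Squnion>((B \<union> B') `` {i})"
      using fin * by (intro sup_mono img) auto
    have cl: "\<Sqinter>((A \<union> A') `` {i}) \<in> carrier T" "\<Sqinter>(A `` {i}) \<in> carrier T"
      "\<Squnion>(B `` {i}) \<in> carrier T" "\<Squnion>((B \<union> B') `` {i}) \<in> carrier T"
      using fin * by (intro inf_closed sup_closed img; simp)+
    have "x (Suc i) \<sqinter> \<Sqinter>((A \<union> A') `` {i}) \<sqsubseteq> x (Suc i) \<sqinter> \<Sqinter>(A `` {i})"
      using x cl inf by (auto simp: le_meet_iff intro: meet_leI1 meet_leI2)
    moreover have "\<Squnion>(B `` {i}) \<squnion> x i \<sqsubseteq> \<Squnion>((B \<union> B') `` {i}) \<squnion> x i"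
      using x cl sup by (auto simp: join_le_iff intro: le_joinI1 le_joinI2)
    ultimately show ?thesis
      using x cl that by (meson le_trans join_closed meet_closed)
  qed
  then show "kr_entails l T (A \<union> A') (B \<union> B')"
    using fin * x by (subst kr_entails_cases) auto
next
  fix A B s
  assume "s \<in> kr_gens l T" and
    *: "finite A \<and> A \<subseteq> kr_gens l T \<and> finite B \<and> B \<subseteq> kr_gens l T \<and>
      kr_entails l T (A \<union> {s}) B \<and> kr_entails l T A (B \<union> {s})"
  then obtain k z where s: "s = (k, z)" "k \<le> l" "z \<in> carrier T"
    by (auto simp: kr_gens_def)
  have fin: "finite A" "A \<subseteq> kr_gens l T" "finite B" "B \<subseteq> kr_gens l T"
    "finite (A \<union> {s})" "A \<union> {s} \<subseteq> kr_gens l T" "finite (B \<union> {s})" "B \<union> {s} \<subseteq> kr_gens l T"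
    using * \<open>s \<in> kr_gens l T\<close> by auto
  define u where "u i = \<Sqinter>(A `` {i})" for i
  define j where "j i = \<Squnion>(B `` {i})" for i
  have cl [simp]: "u i \<in> carrier T" "j i \<in> carrier T" for i
    using fin unfolding u_def j_def
    by (auto simp: kr_gens_def intro!: inf_closed sup_closed)
  have im: "insert s V `` {i} = (if i = k then insert z (V `` {i}) else V `` {i})" for V i
    using s by auto
  have img: "finite (V `` {i})" "V `` {i} \<subseteq> carrier T"
    if "finite V" "V \<subseteq> kr_gens l T" for V i
    using that by (auto simp: kr_gens_def)
  have us: "\<Sqinter>((A \<union> {s}) `` {i}) = (if i = k then z \<sqinter> u i else u i)" for i
    using s(3) img[OF fin(1,2)] by (simp add: im inf_insert u_def)
  have js: "\<Squnion>((B \<union> {s}) `` {i}) = (if i = k then z \<squnion> j i else j i)" for i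
    using s(3) img[OF fin(3,4)] by (simp add: im sup_insert j_def)
  obtain x where x: "x 0 = \<bottom>" "x (Suc l) = \<top>" "\<And>i. x i \<in> carrier T"
    and xs: "\<And>i. i \<le> l \<Longrightarrow> x (Suc i) \<sqinter> \<Sqinter>((A \<union> {s}) `` {i}) \<sqsubseteq> \<Squnion>(B `` {i}) \<squnion> x i"
    using * kr_entails_cases[OF fin(5,6,3,4)] by blast
  obtain y where y: "y 0 = \<bottom>" "y (Suc l) = \<top>" "\<And>i. y i \<in> carrier T"
    and ys: "\<And>i. i \<le> l \<Longrightarrow> y (Suc i) \<sqinter> \<Sqinter>(A `` {i}) \<sqsubseteq> \<Squnion>((B \<union> {s}) `` {i}) \<squnion> y i"
    using * kr_entails_cases[OF fin(1,2,7,8)] by blast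
  note [simp] = x(3) y(3)
  \<comment> \<open>Away from line \<open>k\<close> both solutions satisfy the same line, and such
    lines are stable under joining and under meeting the two solutions. Switching exactly after
    \<open>k\<close> gives line \<open>k\<close> a meet on the left and a join on the right, so that
    both premises can be used there.\<close>
  define w where "w i = (if i \<le> k then x i \<squnion> y i else x i \<sqinter> y i)" for i
  have "w (Suc i) \<sqinter> u i \<sqsubseteq> j i \<squnion> w i" if "i \<le> l" for i
  proof -
    have xi: "x (Suc i) \<sqinter> (if i = k then z \<sqinter> u i else u i) \<sqsubseteq> j i \<squnion> x i"
      using xs[OF that] by (simp only: us j_def)
    have yi: "y (Suc i) \<sqinter> u i \<sqsubseteq> (if i = k then z \<squnion> j i else j i) \<squnion> y i"
      using ys[OF that] by (simp only: js u_def)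
    consider "i < k" | "i = k" | "k < i"
      by linarith
    then show ?thesis
    proof cases
      case 1
      have "(x (Suc i) \<squnion> y (Suc i)) \<sqinter> u i \<sqsubseteq> j i \<squnion> (x i \<squnion> y i)"
      proof (rule join_meet_le)
        have "x (Suc i) \<sqinter> u i \<sqsubseteq> j i \<squnion> x i"
          using 1 xi by simp
        then show "x (Suc i) \<sqinter> u i \<sqsubseteq> j i \<squnion> (x i \<squnion> y i)"
          by (rule le_trans) (simp_all add: join_le_iff le_joinI1 le_joinI2)
        have "y (Suc i) \<sqinter> u i \<sqsubseteq> j i \<squnion> y i"
          using 1 yi by simp
        then show "y (Suc i) \<sqinter> u i \<sqsubseteq> j i \<squnion> (x i \<squnion> y i)"
          by (rule le_trans) (simp_all add: join_le_iff le_joinI1 le_joinI2)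
      qed simp_all
      then show ?thesis
        using 1 by (simp add: w_def)
    next
      case 2
      have "(x (Suc i) \<sqinter> y (Suc i)) \<sqinter> u i \<sqsubseteq> j i \<squnion> (x i \<squnion> y i)"
      \<comment> \<open>With \<open>z\<close> added on the left, line \<open>k\<close> of
        \<open>x\<close> applies; with \<open>z\<close> added on the right, line \<open>k\<close> of
        \<open>y\<close> does.\<close>
      proof (rule cut[of _ z])
        have "((x (Suc i) \<sqinter> y (Suc i)) \<sqinter> u i) \<sqinter> z \<sqsubseteq> x (Suc i) \<sqinter> (z \<sqinter> u i)"
          using s(3) by (simp add: le_meet_iff meet_leI1 meet_leI2)
        moreover have "x (Suc i) \<sqinter> (z \<sqinter> u i) \<sqsubseteq> j i \<squnion> x i"
          using 2 xi by simp
        moreover have "j i \<squnion> x i \<sqsubseteq> j i \<squnion> (x i \<squnion> y i)"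
          by (simp add: join_le_iff le_joinI1 le_joinI2)
        ultimately show "((x (Suc i) \<sqinter> y (Suc i)) \<sqinter> u i) \<sqinter> z \<sqsubseteq> j i \<squnion> (x i \<squnion> y i)"
          using s(3) by (meson cl x(3) y(3) le_trans meet_closed join_closed)
        have "(x (Suc i) \<sqinter> y (Suc i)) \<sqinter> u i \<sqsubseteq> y (Suc i) \<sqinter> u i"
          by (simp add: le_meet_iff meet_leI1 meet_leI2)
        moreover have "y (Suc i) \<sqinter> u i \<sqsubseteq> (z \<squnion> j i) \<squnion> y i"
          using 2 yi by simp
        moreover have "(z \<squnion> j i) \<squnion> y i \<sqsubseteq> (j i \<squnion> (x i \<squnion> y i)) \<squnion> z"
          using s(3) by (simp add: join_le_iff le_joinI1 le_joinI2)
        ultimately show "(x (Suc i) \<sqinter> y (Suc i)) \<sqinter> u i \<sqsubseteq> (j i \<squnion> (x i \<squnion> y i)) \<squnion> z"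
          using s(3) by (meson cl x(3) y(3) le_trans meet_closed join_closed)
      qed (use s(3) in simp_all)
      then show ?thesis
        using 2 by (simp add: w_def)
    next
      case 3
      have "(x (Suc i) \<sqinter> y (Suc i)) \<sqinter> u i \<sqsubseteq> j i \<squnion> (x i \<sqinter> y i)"
      \<comment> \<open>Both \<open>w (Suc i)\<close> and \<open>w i\<close> are meets here, so the
        dual distributive law is needed on the right.\<close>
      proof (rule le_join_meet)
        have "x (Suc i) \<sqinter> u i \<sqsubseteq> j i \<squnion> x i"
          using 3 xi by simp
        then show "(x (Suc i) \<sqinter> y (Suc i)) \<sqinter> u i \<sqsubseteq> j i \<squnion> x i"
          by (rule le_trans[rotated]) (simp_all add: le_meet_iff meet_leI1 meet_leI2)
        have "y (Suc i) \<sqinter> u i \<sqsubseteq> j i \<squnion> y i"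
          using 3 yi by simp
        then show "(x (Suc i) \<sqinter> y (Suc i)) \<sqinter> u i \<sqsubseteq> j i \<squnion> y i"
          by (rule le_trans[rotated]) (simp_all add: le_meet_iff meet_leI1 meet_leI2)
      qed simp_all
      then show ?thesis
        using 3 by (simp add: w_def)
    qed
  qed
  \<comment> \<open>Since \<open>k\<close> lies between 0 and \<open>l\<close>, index 0 falls under
    the join and \<open>Suc l\<close> under the meet, which preserves the end values.\<close>
  moreover have "w 0 = \<bottom>" "w (Suc l) = \<top>" "\<forall>i. w i \<in> carrier T"
    using x y s by (auto simp: w_def)
  ultimately show "kr_entails l T A B"
    unfolding kr_entails_cases[OF fin(1-4)] u_def j_def by blast
qed

end

section \<open>Homomorphisms\<close>

lemma lattice_hom_closed: "f \<in> lattice_hom L M \<Longrightarrow> x \<in> carrier L \<Longrightarrow> f x \<in> carrier M"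
  by (auto simp: lattice_hom_def)

lemma lattice_hom_mono:
  assumes "f \<in> lattice_hom L M" "x \<in> carrier L" "y \<in> carrier L" "x \<sqsubseteq>\<^bsub>L\<^esub> y"
  shows "f x \<sqsubseteq>\<^bsub>M\<^esub> f y"
  using assms join_pres_isotone[of f L M] by (auto simp: lattice_hom_def isotone_def)

lemma lattice_hom_compose:
  assumes "bounded_distrib_lattice L" "f \<in> lattice_hom L M" "g \<in> lattice_hom M N"
  shows "compose (carrier L) g f \<in> lattice_hom L N"
proof -
  interpret bounded_distrib_lattice L by fact
  show ?thesis
    using assms(2,3) by (auto simp: lattice_hom_def meet_pres_def join_pres_def compose_def Pi_def)
qed

lemma lattice_hom_inf:
  assumes "bounded_distrib_lattice L" "bounded_distrib_lattice M" "f \<in> lattice_hom L M"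
    and "finite A" "A \<subseteq> carrier L"
  shows "f (\<Sqinter>\<^bsub>L\<^esub>A) = \<Sqinter>\<^bsub>M\<^esub>(f ` A)"
proof -
  interpret L: bounded_distrib_lattice L by fact
  interpret M: bounded_distrib_lattice M by fact
  have cl: "f x \<in> carrier M" if "x \<in> carrier L" for x
    using that assms(3) by (rule lattice_hom_closed[rotated])
  show ?thesis
    using assms(4,5)
  proof (induction A)
    case empty
    then show ?case
      using assms(3) by (simp add: lattice_hom_def)
  next
    case (insert a A)
    have "f (a \<sqinter>\<^bsub>L\<^esub> \<Sqinter>\<^bsub>L\<^esub>A) = f a \<sqinter>\<^bsub>M\<^esub> f (\<Sqinter>\<^bsub>L\<^esub>A)"
      using assms(3) insert by (simp add: lattice_hom_def meet_pres_def)
    moreover have "f ` A \<subseteq> carrier M"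
      using insert cl by blast
    ultimately show ?case
      using insert cl by (simp add: L.inf_insert M.inf_insert)
  qed
qed

lemma lattice_hom_sup:
  assumes "bounded_distrib_lattice L" "bounded_distrib_lattice M" "f \<in> lattice_hom L M"
    and "finite A" "A \<subseteq> carrier L"
  shows "f (\<Squnion>\<^bsub>L\<^esub>A) = \<Squnion>\<^bsub>M\<^esub>(f ` A)"
proof -
  interpret L: bounded_distrib_lattice L by fact
  interpret M: bounded_distrib_lattice M by fact
  have cl: "f x \<in> carrier M" if "x \<in> carrier L" for x
    using that assms(3) by (rule lattice_hom_closed[rotated])
  show ?thesis
    using assms(4,5)
  proof (induction A)
    case empty
    then show ?case
      using assms(3) by (simp add: lattice_hom_def)
  next
    case (insert a A)
    have "f (a \<squnion>\<^bsub>L\<^esub> \<Squnion>\<^bsub>L\<^esub>A) = f a \<squnion>\<^bsub>M\<^esub> f (\<Squnion>\<^bsub>L\<^esub>A)"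
      using assms(3) insert by (simp add: lattice_hom_def join_pres_def)
    moreover have "f ` A \<subseteq> carrier M"
      using insert cl by blast
    ultimately show ?case
      using insert cl by (simp add: L.sup_insert M.sup_insert)
  qed
qed

text \<open>The entailments from \<open>A\<close> to its infimum, and from that infimum to each
  member of \<open>A\<close>, force \<open>f\<close> to preserve finite infima; dually for suprema.
  The sets \<open>{}\<close> and \<open>{a, b}\<close> then give the bounds and the binary
  operations. This lets homomorphisms into the generated lattice be recognised from its relations
  alone.\<close>

lemma lattice_hom_if_lat_entails:
  assumes "bounded_distrib_lattice L" "bounded_distrib_lattice M"
    and f: "f \<in> carrier L \<rightarrow> carrier M"
    and ent: "\<And>A B. finite A \<Longrightarrow> A \<subseteq> carrier L \<Longrightarrow> finite B \<Longrightarrow> B \<subseteq> carrier L \<Longrightarrow>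
      lat_entails L A B \<Longrightarrow> lat_entails M (f ` A) (f ` B)"
  shows "f \<in> lattice_hom L M"
proof -
  interpret L: bounded_distrib_lattice L by fact
  interpret M: bounded_distrib_lattice M by fact
  have inf: "f (\<Sqinter>\<^bsub>L\<^esub>A) = \<Sqinter>\<^bsub>M\<^esub>(f ` A)" if "finite A" "A \<subseteq> carrier L" for A
  proof (rule M.le_antisym)
    have *: "f ` A \<subseteq> carrier M" "\<Sqinter>\<^bsub>L\<^esub>A \<in> carrier L"
      using f that by auto
    then show "f (\<Sqinter>\<^bsub>L\<^esub>A) \<in> carrier M" "\<Sqinter>\<^bsub>M\<^esub>(f ` A) \<in> carrier M"
      using f that by auto
    then show "\<Sqinter>\<^bsub>M\<^esub>(f ` A) \<sqsubseteq>\<^bsub>M\<^esub> f (\<Sqinter>\<^bsub>L\<^esub>A)"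
      using ent[of A "{\<Sqinter>\<^bsub>L\<^esub>A}"] that * by (simp add: lat_entails_def)
    show "f (\<Sqinter>\<^bsub>L\<^esub>A) \<sqsubseteq>\<^bsub>M\<^esub> \<Sqinter>\<^bsub>M\<^esub>(f ` A)"
    proof (rule M.le_inf)
      fix b
      assume "b \<in> f ` A"
      then obtain a where a: "a \<in> A" "b = f a"
        by blast
      then have "a \<in> carrier L" "f a \<in> carrier M"
        using f that by auto
      then show "f (\<Sqinter>\<^bsub>L\<^esub>A) \<sqsubseteq>\<^bsub>M\<^esub> b"
        using ent[of "{\<Sqinter>\<^bsub>L\<^esub>A}" "{a}"] a that * \<open>f (\<Sqinter>\<^bsub>L\<^esub>A) \<in> carrier M\<close>
        by (simp add: lat_entails_def L.inf_lower)
    qed (use that * \<open>f (\<Sqinter>\<^bsub>L\<^esub>A) \<in> carrier M\<close> in auto)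
  qed
  have sup: "f (\<Squnion>\<^bsub>L\<^esub>A) = \<Squnion>\<^bsub>M\<^esub>(f ` A)" if "finite A" "A \<subseteq> carrier L" for A
  proof (rule M.le_antisym)
    have *: "f ` A \<subseteq> carrier M" "\<Squnion>\<^bsub>L\<^esub>A \<in> carrier L"
      using f that by auto
    then show "f (\<Squnion>\<^bsub>L\<^esub>A) \<in> carrier M" "\<Squnion>\<^bsub>M\<^esub>(f ` A) \<in> carrier M"
      using f that by auto
    then show "f (\<Squnion>\<^bsub>L\<^esub>A) \<sqsubseteq>\<^bsub>M\<^esub> \<Squnion>\<^bsub>M\<^esub>(f ` A)"
      using ent[of "{\<Squnion>\<^bsub>L\<^esub>A}" A] that * by (simp add: lat_entails_def)
    show "\<Squnion>\<^bsub>M\<^esub>(f ` A) \<sqsubseteq>\<^bsub>M\<^esub> f (\<Squnion>\<^bsub>L\<^esub>A)"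
    proof (rule M.sup_le)
      fix b
      assume "b \<in> f ` A"
      then obtain a where a: "a \<in> A" "b = f a"
        by blast
      then have "a \<in> carrier L" "f a \<in> carrier M"
        using f that by auto
      then show "b \<sqsubseteq>\<^bsub>M\<^esub> f (\<Squnion>\<^bsub>L\<^esub>A)"
        using ent[of "{a}" "{\<Squnion>\<^bsub>L\<^esub>A}"] a that * \<open>f (\<Squnion>\<^bsub>L\<^esub>A) \<in> carrier M\<close>
        by (simp add: lat_entails_def L.sup_upper)
    qed (use that * \<open>f (\<Squnion>\<^bsub>L\<^esub>A) \<in> carrier M\<close> in auto)
  qed
  have "lattice L" "lattice M"
    by (rule L.lattice_axioms M.lattice_axioms)+
  moreover have "f (a \<sqinter>\<^bsub>L\<^esub> b) = f a \<sqinter>\<^bsub>M\<^esub> f b" "f (a \<squnion>\<^bsub>L\<^esub> b) = f a \<squnion>\<^bsub>M\<^esub> f b"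
    if "a \<in> carrier L" "b \<in> carrier L" for a b
    using inf[of "{a, b}"] sup[of "{a, b}"] that by (simp_all add: meet_def join_def)
  ultimately show ?thesis
    using f inf[of "{}"] sup[of "{}"] by (simp add: lattice_hom_def meet_pres_def join_pres_def)
qed

section \<open>The lattice generated by an entailment relation\<close>

lemma terms_over_simps [simp]:
  "Gen s \<in> terms_over S \<longleftrightarrow> s \<in> S"
  "Bot \<in> terms_over S" "Top \<in> terms_over S"
  "Meet t u \<in> terms_over S \<longleftrightarrow> t \<in> terms_over S \<and> u \<in> terms_over S"
  "Join t u \<in> terms_over S \<longleftrightarrow> t \<in> terms_over S \<and> u \<in> terms_over S"
  by (auto simp: terms_over_def)

lemma Meets_simps [simp]: "Meets [] = Top" "Meets (x # xs) = Meet (Gen x) (Meets xs)"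
  by (simp_all add: Meets_def)

lemma Joins_simps [simp]: "Joins [] = Bot" "Joins (x # xs) = Join (Gen x) (Joins xs)"
  by (simp_all add: Joins_def)

lemma Meets_in_terms_over [simp]: "Meets xs \<in> terms_over S \<longleftrightarrow> set xs \<subseteq> S"
  by (induction xs) auto

lemma Joins_in_terms_over [simp]: "Joins xs \<in> terms_over S \<longleftrightarrow> set xs \<subseteq> S"
  by (induction xs) auto

lemma term_le_in_terms_over:
  "term_le S E t u \<Longrightarrow> t \<in> terms_over S \<and> u \<in> terms_over S"
  by (induction rule: term_le.induct) auto

primrec term_eval :: "'b gorder \<Rightarrow> ('s \<Rightarrow> 'b) \<Rightarrow> 's lat_term \<Rightarrow> 'b" where
  "term_eval M f (Gen s) = f s"
| "term_eval M f Bot = \<bottom>\<^bsub>M\<^esub>"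
| "term_eval M f Top = \<top>\<^bsub>M\<^esub>"
| "term_eval M f (Meet t u) = term_eval M f t \<sqinter>\<^bsub>M\<^esub> term_eval M f u"
| "term_eval M f (Join t u) = term_eval M f t \<squnion>\<^bsub>M\<^esub> term_eval M f u"

context
  fixes M :: "'b gorder" and f :: "'s \<Rightarrow> 'b" and S :: "'s set"
  assumes M: "bounded_distrib_lattice M" and f: "f \<in> S \<rightarrow> carrier M"
begin

interpretation M: bounded_distrib_lattice M
  by (rule M)

lemma term_eval_closed: "t \<in> terms_over S \<Longrightarrow> term_eval M f t \<in> carrier M"
  using f by (induction t) auto

lemma term_eval_Meets: "set xs \<subseteq> S \<Longrightarrow> term_eval M f (Meets xs) = \<Sqinter>\<^bsub>M\<^esub>(f ` set xs)"
proof (induction xs)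
  case (Cons x xs)
  then show ?case
    using f by (auto intro!: M.inf_insert[symmetric])
qed simp

lemma term_eval_Joins: "set xs \<subseteq> S \<Longrightarrow> term_eval M f (Joins xs) = \<Squnion>\<^bsub>M\<^esub>(f ` set xs)"
proof (induction xs)
  case (Cons x xs)
  then show ?case
    using f by (auto intro!: M.sup_insert[symmetric])
qed simp

text \<open>Soundness of the rules of \<open>term_le\<close> in any bounded distributive lattice
  where the images of the generators satisfy the relations. It makes evaluation well defined on
  classes.\<close>

lemma term_eval_mono:
  assumes ent: "\<And>A B. finite A \<Longrightarrow> A \<subseteq> S \<Longrightarrow> finite B \<Longrightarrow> B \<subseteq> S \<Longrightarrow> E A B \<Longrightarrow>
      lat_entails M (f ` A) (f ` B)"
    and "term_le S E t u"
  shows "term_eval M f t \<sqsubseteq>\<^bsub>M\<^esub> term_eval M f u"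
  using assms(2)
proof (induction rule: term_le.induct)
  case (trans t u v)
  then show ?case
    using M.le_trans term_le_in_terms_over term_eval_closed by metis
next
  case (meet v t u)
  then show ?case
    using M.meet_le term_le_in_terms_over[of S E] term_eval_closed by auto
next
  case (join t v u)
  then show ?case
    using M.join_le term_le_in_terms_over[of S E] term_eval_closed by auto
next
  case (rel xs ys)
  then show ?case
    using ent[of "set xs" "set ys"] by (simp add: term_eval_Meets term_eval_Joins lat_entails_def)
qed (auto simp: term_eval_closed M.meet_left M.meet_right M.join_left M.join_right M.meet_join_distrib)

end

section \<open>The lattice of term classes and its universal property\<close>

context
  fixes S :: "'s set" and E :: "'s set \<Rightarrow> 's set \<Rightarrow> bool"
begin

abbreviation (input) "cls \<equiv> term_class S E"
abbreviation (input) "G \<equiv> generated_lattice S E"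

lemma carrier_generated_lattice: "carrier G = cls ` terms_over S"
  by (simp add: generated_lattice_def)

lemma term_class_closed [simp]: "t \<in> terms_over S \<Longrightarrow> cls t \<in> carrier G"
  by (simp add: generated_lattice_def)

lemma term_class_refl: "t \<in> terms_over S \<Longrightarrow> t \<in> cls t"
  by (simp add: term_class_def term_le.refl)

text \<open>The order asks for some pair of comparable representatives; transitivity carries the
  comparison over to \<open>t\<close> and \<open>u\<close>.\<close>

lemma le_generated_lattice:
  assumes "t \<in> terms_over S" "u \<in> terms_over S"
  shows "cls t \<sqsubseteq>\<^bsub>G\<^esub> cls u \<longleftrightarrow> term_le S E t u"
proof
  assume "cls t \<sqsubseteq>\<^bsub>G\<^esub> cls u"
  then show "term_le S E t u"
    by (auto simp: generated_lattice_def term_class_def intro: term_le.trans)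
next
  assume "term_le S E t u"
  then show "cls t \<sqsubseteq>\<^bsub>G\<^esub> cls u"
    using assms term_class_refl by (auto simp: generated_lattice_def)
qed

lemma term_class_eqI: "term_le S E t u \<Longrightarrow> term_le S E u t \<Longrightarrow> cls t = cls u"
  by (auto simp: term_class_def intro: term_le.trans)

lemma greatest_generated_lattice:
  assumes "t \<in> terms_over S" "u \<in> terms_over S"
  shows "greatest G (cls (Meet t u)) (Lower G {cls t, cls u})"
proof (rule greatest_LowerI)
  fix X
  assume "X \<in> {cls t, cls u}"
  then show "cls (Meet t u) \<sqsubseteq>\<^bsub>G\<^esub> X"
    using assms term_le.meet1[of t S u E] term_le.meet2[of t S u E]
    by (elim insertE) (simp_all add: le_generated_lattice)
next
  fix X
  assume X: "X \<in> Lower G {cls t, cls u}"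
  then obtain v where v: "v \<in> terms_over S" "X = cls v"
    by (auto simp: Lower_def carrier_generated_lattice)
  have "X \<sqsubseteq>\<^bsub>G\<^esub> cls t" "X \<sqsubseteq>\<^bsub>G\<^esub> cls u"
    using X assms by (simp_all add: Lower_def)
  then show "X \<sqsubseteq>\<^bsub>G\<^esub> cls (Meet t u)"
    using assms v by (simp add: le_generated_lattice term_le.meet)
qed (use assms in auto)

lemma least_generated_lattice:
  assumes "t \<in> terms_over S" "u \<in> terms_over S"
  shows "least G (cls (Join t u)) (Upper G {cls t, cls u})"
proof (rule least_UpperI)
  fix X
  assume "X \<in> {cls t, cls u}"
  then show "X \<sqsubseteq>\<^bsub>G\<^esub> cls (Join t u)"
    using assms term_le.join1[of t S u E] term_le.join2[of t S u E]
    by (elim insertE) (simp_all add: le_generated_lattice)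
next
  fix X
  assume X: "X \<in> Upper G {cls t, cls u}"
  then obtain v where v: "v \<in> terms_over S" "X = cls v"
    by (auto simp: Upper_def carrier_generated_lattice)
  have "cls t \<sqsubseteq>\<^bsub>G\<^esub> X" "cls u \<sqsubseteq>\<^bsub>G\<^esub> X"
    using X assms by (simp_all add: Upper_def)
  then show "cls (Join t u) \<sqsubseteq>\<^bsub>G\<^esub> X"
    using assms v by (simp add: le_generated_lattice term_le.join)
qed (use assms in auto)

lemma bounded_lattice_generated_lattice: "bounded_lattice G"
proof unfold_locales
  show eq: "(.=\<^bsub>G\<^esub>) = (=)"
    by (simp add: generated_lattice_def)
  show "x .=\<^bsub>G\<^esub> x" for x
    by (simp add: eq)
  show "x .=\<^bsub>G\<^esub> y \<Longrightarrow> y .=\<^bsub>G\<^esub> x" for x y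
    by (simp add: eq)
  show "x .=\<^bsub>G\<^esub> y \<Longrightarrow> y .=\<^bsub>G\<^esub> z \<Longrightarrow> x .=\<^bsub>G\<^esub> z" for x y z
    by (simp add: eq)
  show "x .=\<^bsub>G\<^esub> y \<Longrightarrow> z .=\<^bsub>G\<^esub> w \<Longrightarrow> x \<sqsubseteq>\<^bsub>G\<^esub> z \<longleftrightarrow> y \<sqsubseteq>\<^bsub>G\<^esub> w" for x y z w
    by (simp add: eq)
  show "x \<in> carrier G \<Longrightarrow> x \<sqsubseteq>\<^bsub>G\<^esub> x" for x
    by (auto simp: carrier_generated_lattice le_generated_lattice intro: term_le.refl)
  show "x \<sqsubseteq>\<^bsub>G\<^esub> y \<Longrightarrow> y \<sqsubseteq>\<^bsub>G\<^esub> x \<Longrightarrow> x \<in> carrier G \<Longrightarrow> y \<in> carrier G \<Longrightarrow> x .=\<^bsub>G\<^esub> y" for x y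
    by (auto simp: eq carrier_generated_lattice le_generated_lattice intro!: term_class_eqI)
  show "x \<sqsubseteq>\<^bsub>G\<^esub> y \<Longrightarrow> y \<sqsubseteq>\<^bsub>G\<^esub> z \<Longrightarrow> x \<in> carrier G \<Longrightarrow> y \<in> carrier G \<Longrightarrow> z \<in> carrier G \<Longrightarrow>
      x \<sqsubseteq>\<^bsub>G\<^esub> z" for x y z
    by (auto simp: carrier_generated_lattice le_generated_lattice intro: term_le.trans)
  show "x \<in> carrier G \<Longrightarrow> y \<in> carrier G \<Longrightarrow> \<exists>s. least G s (Upper G {x, y})" for x y
    using least_generated_lattice by (auto simp: carrier_generated_lattice)
  show "x \<in> carrier G \<Longrightarrow> y \<in> carrier G \<Longrightarrow> \<exists>s. greatest G s (Lower G {x, y})" for x y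
    using greatest_generated_lattice by (auto simp: carrier_generated_lattice)
  show "\<exists>x. least G x (carrier G)"
    by (rule exI[of _ "cls Bot"])
      (auto simp: least_def carrier_generated_lattice le_generated_lattice intro: term_le.bot)
  show "\<exists>x. greatest G x (carrier G)"
    by (rule exI[of _ "cls Top"])
      (auto simp: greatest_def carrier_generated_lattice le_generated_lattice intro: term_le.top)
qed

lemma term_class_Bot: "cls Bot = \<bottom>\<^bsub>G\<^esub>"
  by (rule bounded_lattice.bottom_eq[OF bounded_lattice_generated_lattice])
    (auto simp: carrier_generated_lattice le_generated_lattice intro: term_le.bot)

lemma term_class_Top: "cls Top = \<top>\<^bsub>G\<^esub>"
  by (rule bounded_lattice.top_eq[OF bounded_lattice_generated_lattice])
    (auto simp: carrier_generated_lattice le_generated_lattice intro: term_le.top)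

text \<open>Both sides are greatest lower bounds of the same pair, hence equal. From here on,
  operations in \<open>G\<close> can be computed on terms.\<close>

lemma term_class_Meet:
  assumes "t \<in> terms_over S" "u \<in> terms_over S"
  shows "cls (Meet t u) = cls t \<sqinter>\<^bsub>G\<^esub> cls u"
proof -
  interpret G: bounded_lattice G
    by (rule bounded_lattice_generated_lattice)
  show ?thesis
    using assms
    by (intro G.greatest_unique[OF greatest_generated_lattice])
      (auto simp: meet_def intro: G.inf_of_two_greatest)
qed

lemma term_class_Join:
  assumes "t \<in> terms_over S" "u \<in> terms_over S"
  shows "cls (Join t u) = cls t \<squnion>\<^bsub>G\<^esub> cls u"
proof -
  interpret G: bounded_lattice G
    by (rule bounded_lattice_generated_lattice)
  show ?thesis
    using assms
    by (intro G.least_unique[OF least_generated_lattice])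
      (auto simp: join_def intro: G.sup_of_two_least)
qed

lemma bounded_distrib_lattice_generated_lattice: "bounded_distrib_lattice G"
proof -
  interpret G: bounded_lattice G
    by (rule bounded_lattice_generated_lattice)
  show ?thesis
  proof unfold_locales
    fix x y z
    assume xyz: "x \<in> carrier G" "y \<in> carrier G" "z \<in> carrier G"
    then obtain t u v where "t \<in> terms_over S" "u \<in> terms_over S" "v \<in> terms_over S"
      "x = cls t" "y = cls u" "z = cls v"
      by (auto simp: carrier_generated_lattice)
    \<comment> \<open>The rule \<open>distrib\<close> supplies this inequality; the reverse one
      holds in every lattice.\<close>
    then have "x \<sqinter>\<^bsub>G\<^esub> (y \<squnion>\<^bsub>G\<^esub> z) \<sqsubseteq>\<^bsub>G\<^esub> (x \<sqinter>\<^bsub>G\<^esub> y) \<squnion>\<^bsub>G\<^esub> (x \<sqinter>\<^bsub>G\<^esub> z)"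
      using term_le.distrib[of t S u v E]
      by (simp add: le_generated_lattice flip: term_class_Meet term_class_Join)
    moreover have "(x \<sqinter>\<^bsub>G\<^esub> y) \<squnion>\<^bsub>G\<^esub> (x \<sqinter>\<^bsub>G\<^esub> z) \<sqsubseteq>\<^bsub>G\<^esub> x \<sqinter>\<^bsub>G\<^esub> (y \<squnion>\<^bsub>G\<^esub> z)"
    proof (intro G.join_le G.meet_le)
      show "x \<sqinter>\<^bsub>G\<^esub> y \<sqsubseteq>\<^bsub>G\<^esub> y \<squnion>\<^bsub>G\<^esub> z"
        using xyz G.le_trans[OF G.meet_right G.join_left] by simp
      show "x \<sqinter>\<^bsub>G\<^esub> z \<sqsubseteq>\<^bsub>G\<^esub> y \<squnion>\<^bsub>G\<^esub> z"
        using xyz G.le_trans[OF G.meet_right G.join_right] by simp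
    qed (use xyz in \<open>simp_all add: G.meet_left\<close>)
    ultimately show "x \<sqinter>\<^bsub>G\<^esub> (y \<squnion>\<^bsub>G\<^esub> z) = (x \<sqinter>\<^bsub>G\<^esub> y) \<squnion>\<^bsub>G\<^esub> (x \<sqinter>\<^bsub>G\<^esub> z)"
      using xyz by (intro G.le_antisym) simp_all
  qed
qed

interpretation G: bounded_distrib_lattice G
  by (rule bounded_distrib_lattice_generated_lattice)

text \<open>Identifies the quotient map with evaluation at the canonical generators, so that the
  evaluation lemmas turn \<open>Meets\<close> and \<open>Joins\<close> into finite infima and
  suprema in \<open>G\<close>.\<close>

lemma term_class_eq_term_eval: "t \<in> terms_over S \<Longrightarrow> cls t = term_eval G (\<lambda>s. cls (Gen s)) t"
  by (induction t) (simp_all add: term_class_Bot term_class_Top term_class_Meet term_class_Join)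

text \<open>The rule \<open>rel\<close> read inside \<open>G\<close>, for arbitrary enumerations of
  \<open>A\<close> and \<open>B\<close>; evaluation depends only on the sets enumerated.\<close>

lemma generated_lattice_entails:
  assumes "finite A" "A \<subseteq> S" "finite B" "B \<subseteq> S" "E A B"
  shows "lat_entails G ((\<lambda>s. cls (Gen s)) ` A) ((\<lambda>s. cls (Gen s)) ` B)"
proof -
  obtain xs ys where xs: "set xs = A" "set ys = B"
    using assms finite_list by metis
  let ?g = "\<lambda>s. cls (Gen s)"
  have g: "?g \<in> S \<rightarrow> carrier G"
    by simp
  have "cls (Meets xs) \<sqsubseteq>\<^bsub>G\<^esub> cls (Joins ys)"
    using assms xs by (simp add: le_generated_lattice term_le.rel)
  then show ?thesis
    using xs assms term_eval_Meets[OF G.bounded_distrib_lattice_axioms g, of xs]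
      term_eval_Joins[OF G.bounded_distrib_lattice_axioms g, of ys]
    by (simp add: lat_entails_def term_class_eq_term_eval[symmetric])
qed

text \<open>A homomorphism out of \<open>G\<close> is determined by its values on generators; this
  is the source of uniqueness below.\<close>

lemma lattice_hom_term_class:
  assumes "\<eta> \<in> lattice_hom G M" "t \<in> terms_over S"
  shows "\<eta> (cls t) = term_eval M (\<lambda>s. \<eta> (cls (Gen s))) t"
  using assms(2)
proof (induction t)
  case (Meet t u)
  then show ?case
    using assms(1) by (simp add: term_class_Meet lattice_hom_def meet_pres_def)
next
  case (Join t u)
  then show ?case
    using assms(1) by (simp add: term_class_Join lattice_hom_def join_pres_def)
qed (use assms(1) in \<open>simp_all add: term_class_Bot term_class_Top lattice_hom_def\<close>)

lemma term_eval_cong: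
  "t \<in> terms_over S \<Longrightarrow> (\<And>s. s \<in> S \<Longrightarrow> f s = g s) \<Longrightarrow> term_eval M f t = term_eval M g t"
  by (induction t) auto

text \<open>Existence comes from evaluating terms, uniqueness from
  \<open>lattice_hom_term_class\<close>; extensionality extends the agreement on the carrier to
  equality of functions.\<close>

lemma generated_lattice_universal:
  assumes "bounded_distrib_lattice M" "f \<in> S \<rightarrow> carrier M"
    and ent: "\<And>A B. finite A \<Longrightarrow> A \<subseteq> S \<Longrightarrow> finite B \<Longrightarrow> B \<subseteq> S \<Longrightarrow> E A B \<Longrightarrow>
      lat_entails M (f ` A) (f ` B)"
  shows "\<exists>!\<eta>. \<eta> \<in> lattice_hom G M \<and> \<eta> \<in> extensional (carrier G) \<and>
    (\<forall>s\<in>S. \<eta> (cls (Gen s)) = f s)"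
proof (rule ex_ex1I)
  interpret M: bounded_distrib_lattice M by fact
  define \<eta> where
    "\<eta> = restrict (\<lambda>X. term_eval M f (SOME t. t \<in> terms_over S \<and> X = cls t)) (carrier G)"
  \<comment> \<open>The value does not depend on the chosen representative: equal classes give
    inequalities between terms in both directions, which evaluation preserves.\<close>
  have \<eta>: "\<eta> (cls t) = term_eval M f t" if "t \<in> terms_over S" for t
  proof -
    define u where "u = (SOME u. u \<in> terms_over S \<and> cls t = cls u)"
    have u: "u \<in> terms_over S" "cls t = cls u"
      using someI[of "\<lambda>u. u \<in> terms_over S \<and> cls t = cls u" t] that by (auto simp: u_def)
    then have "term_le S E t u" "term_le S E u t"
      using le_generated_lattice[of t u] le_generated_lattice[of u t] that by auto
    then have "term_eval M f t = term_eval M f u"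
      using assms that u by (intro M.le_antisym term_eval_mono[of M f S E] term_eval_closed)
    then show ?thesis
      using that by (simp add: \<eta>_def u_def)
  qed
  have "\<eta> \<in> lattice_hom G M"
    using term_eval_closed[OF assms(1,2)] G.lattice_axioms M.lattice_axioms
    by (auto simp: lattice_hom_def meet_pres_def join_pres_def carrier_generated_lattice \<eta>
        term_class_Bot[symmetric] term_class_Top[symmetric]
        term_class_Meet[symmetric] term_class_Join[symmetric])
  moreover have "\<eta> \<in> extensional (carrier G)"
    by (simp add: \<eta>_def)
  ultimately show "\<exists>\<eta>. \<eta> \<in> lattice_hom G M \<and> \<eta> \<in> extensional (carrier G) \<and>
      (\<forall>s\<in>S. \<eta> (cls (Gen s)) = f s)"
    by (auto simp: \<eta> intro!: exI[of _ \<eta>])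
next
  fix \<eta> \<eta>'
  assume *: "\<eta> \<in> lattice_hom G M \<and> \<eta> \<in> extensional (carrier G) \<and> (\<forall>s\<in>S. \<eta> (cls (Gen s)) = f s)"
    "\<eta>' \<in> lattice_hom G M \<and> \<eta>' \<in> extensional (carrier G) \<and> (\<forall>s\<in>S. \<eta>' (cls (Gen s)) = f s)"
  show "\<eta> = \<eta>'"
  proof (rule extensionalityI[of _ "carrier G"])
    fix X
    assume "X \<in> carrier G"
    then obtain t where t: "t \<in> terms_over S" "X = cls t"
      by (auto simp: carrier_generated_lattice)
    then show "\<eta> X = \<eta>' X"
      using * lattice_hom_term_class[of \<eta> M t] lattice_hom_term_class[of \<eta>' M t]
        term_eval_cong[of t "\<lambda>s. \<eta> (cls (Gen s))" "\<lambda>s. \<eta>' (cls (Gen s))" M]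
      by simp
  qed (use * in auto)
qed

end

section \<open>The universal property\<close>

text \<open>Verifies the hypothesis on relations in \<open>generated_lattice_universal\<close> for
  the map induced by a chain. Since \<open>p\<close> and \<open>q\<close> range over all copies at
  once, they bound the part of each copy, and every line of the system can be weakened to an
  inequality between \<open>p\<close> and \<open>q\<close>.\<close>

lemma hom_chain_lat_entails:
  assumes T: "bounded_distrib_lattice T" and M: "bounded_distrib_lattice M"
    and chain: "hom_chain l T M \<psi>" and ent: "kr_entails l T A B"
  shows "lat_entails M ((\<lambda>(i, x). \<psi> i x) ` A) ((\<lambda>(i, x). \<psi> i x) ` B)"
proof -
  interpret T: bounded_distrib_lattice T by fact
  interpret M: bounded_distrib_lattice M by fact
  let ?f = "\<lambda>(i, x). \<psi> i x"
  have fin: "finite A" "A \<subseteq> kr_gens l T" "finite B" "B \<subseteq> kr_gens l T"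
    using ent by (auto simp: kr_entails_def)
  have hom: "\<psi> i \<in> lattice_hom T M" if "i \<le> l" for i
    using chain that by (simp add: hom_chain_def)
  have cl: "\<psi> i a \<in> carrier M" if "i \<le> l" "a \<in> carrier T" for i a
    using lattice_hom_closed[OF hom] that by simp
  have img: "finite (V `` {i})" "V `` {i} \<subseteq> carrier T" "finite (?f ` V)" "?f ` V \<subseteq> carrier M"
    if "finite V" "V \<subseteq> kr_gens l T" for V i
    using that cl by (auto simp: kr_gens_def)
  define p where "p = \<Sqinter>\<^bsub>M\<^esub>(?f ` A)"
  define q where "q = \<Squnion>\<^bsub>M\<^esub>(?f ` B)"
  define u where "u i = \<Sqinter>\<^bsub>T\<^esub>(A `` {i})" for i
  define j where "j i = \<Squnion>\<^bsub>T\<^esub>(B `` {i})" for i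
  have cl' [simp]: "p \<in> carrier M" "q \<in> carrier M" "u i \<in> carrier T" "j i \<in> carrier T" for i
    using img fin by (simp_all add: p_def q_def u_def j_def)
  obtain x where x: "x 0 = \<bottom>\<^bsub>T\<^esub>" "x (Suc l) = \<top>\<^bsub>T\<^esub>" "\<And>i. x i \<in> carrier T"
    and xs: "\<And>i. i \<le> l \<Longrightarrow> x (Suc i) \<sqinter>\<^bsub>T\<^esub> u i \<sqsubseteq>\<^bsub>T\<^esub> j i \<squnion>\<^bsub>T\<^esub> x i"
    using ent kr_entails_cases[OF T fin] unfolding u_def j_def by blast
  have pu: "p \<sqsubseteq>\<^bsub>M\<^esub> \<psi> i (u i)" if "i \<le> l" for i
  proof -
    have "\<psi> i ` A `` {i} \<subseteq> ?f ` A"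
      by force
    then show ?thesis
      using that img fin lattice_hom_inf[OF T M hom[OF that], of "A `` {i}"]
      by (simp add: p_def u_def M.inf_antimono)
  qed
  have jq: "\<psi> i (j i) \<sqsubseteq>\<^bsub>M\<^esub> q" if "i \<le> l" for i
  proof -
    have "\<psi> i ` B `` {i} \<subseteq> ?f ` B"
      by force
    then show ?thesis
      using that img fin lattice_hom_sup[OF T M hom[OF that], of "B `` {i}"]
      by (simp add: q_def j_def M.sup_mono)
  qed
  \<comment> \<open>Line \<open>i\<close> transported along \<open>\<psi> i\<close>, with
    \<open>u i\<close> and \<open>j i\<close> weakened to \<open>p\<close> and
    \<open>q\<close>.\<close>
  have step: "p \<sqinter>\<^bsub>M\<^esub> \<psi> i (x (Suc i)) \<sqsubseteq>\<^bsub>M\<^esub> q \<squnion>\<^bsub>M\<^esub> \<psi> i (x i)" if "i \<le> l" for i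
  proof -
    have "\<psi> i (x (Suc i) \<sqinter>\<^bsub>T\<^esub> u i) \<sqsubseteq>\<^bsub>M\<^esub> \<psi> i (j i \<squnion>\<^bsub>T\<^esub> x i)"
      using xs[OF that] x by (intro lattice_hom_mono[OF hom[OF that]]) auto
    then have "\<psi> i (x (Suc i)) \<sqinter>\<^bsub>M\<^esub> \<psi> i (u i) \<sqsubseteq>\<^bsub>M\<^esub> \<psi> i (j i) \<squnion>\<^bsub>M\<^esub> \<psi> i (x i)"
      using hom[OF that] x by (simp add: lattice_hom_def meet_pres_def join_pres_def)
    moreover have "p \<sqinter>\<^bsub>M\<^esub> \<psi> i (x (Suc i)) \<sqsubseteq>\<^bsub>M\<^esub> \<psi> i (x (Suc i)) \<sqinter>\<^bsub>M\<^esub> \<psi> i (u i)"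
      using pu[OF that] x cl[OF that] by (auto simp: M.le_meet_iff intro: M.meet_leI1 M.meet_leI2)
    moreover have "\<psi> i (j i) \<squnion>\<^bsub>M\<^esub> \<psi> i (x i) \<sqsubseteq>\<^bsub>M\<^esub> q \<squnion>\<^bsub>M\<^esub> \<psi> i (x i)"
      using jq[OF that] x cl[OF that] by (auto simp: M.join_le_iff intro: M.le_joinI1 M.le_joinI2)
    ultimately show ?thesis
      using x cl[OF that] by (meson M.le_trans M.join_closed M.meet_closed cl')
  qed
  have "p \<sqinter>\<^bsub>M\<^esub> \<psi> i (x (Suc i)) \<sqsubseteq>\<^bsub>M\<^esub> q" if "i \<le> l" for i
    using that
  proof (induction i)
    case 0
    then show ?case
      \<comment> \<open>As \<open>x 0\<close> is bottom, its image disappears from the right-hand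
        side.\<close>
      using step[of 0] hom[of 0] x by (simp add: lattice_hom_def)
  next
    case (Suc i)
    have c: "\<psi> (Suc i) (x (Suc i)) \<in> carrier M" "\<psi> i (x (Suc i)) \<in> carrier M"
      "\<psi> (Suc i) (x (Suc (Suc i))) \<in> carrier M"
      using Suc.prems x cl by auto
    \<comment> \<open>The induction hypothesis concerns \<open>\<psi> i\<close>, whereas line
      \<open>Suc i\<close> contains the image under \<open>\<psi> (Suc i)\<close>. The decreasing
      chain bridges the two, and this image is then cut.\<close>
    have "\<psi> (Suc i) (x (Suc i)) \<sqsubseteq>\<^bsub>M\<^esub> \<psi> i (x (Suc i))"
      using chain Suc.prems x by (auto simp: hom_chain_def hom_le_def)
    then have "p \<sqinter>\<^bsub>M\<^esub> \<psi> (Suc i) (x (Suc i)) \<sqsubseteq>\<^bsub>M\<^esub> p \<sqinter>\<^bsub>M\<^esub> \<psi> i (x (Suc i))"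
      using c by (auto simp: M.le_meet_iff M.meet_left intro: M.meet_leI2)
    also have "p \<sqinter>\<^bsub>M\<^esub> \<psi> i (x (Suc i)) \<sqsubseteq>\<^bsub>M\<^esub> q"
      using Suc by simp
    finally have le: "p \<sqinter>\<^bsub>M\<^esub> \<psi> (Suc i) (x (Suc i)) \<sqsubseteq>\<^bsub>M\<^esub> q"
      using c by simp
    show ?case
    proof (rule M.cut)
      show "p \<sqinter>\<^bsub>M\<^esub> \<psi> (Suc i) (x (Suc (Suc i))) \<sqsubseteq>\<^bsub>M\<^esub> q \<squnion>\<^bsub>M\<^esub> \<psi> (Suc i) (x (Suc i))"
        using step Suc.prems by simp
      show "p \<sqinter>\<^bsub>M\<^esub> \<psi> (Suc i) (x (Suc (Suc i))) \<sqinter>\<^bsub>M\<^esub> \<psi> (Suc i) (x (Suc i)) \<sqsubseteq>\<^bsub>M\<^esub> q"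
        using c by (intro M.le_trans[OF _ le]) (auto simp: M.le_meet_iff M.meet_right M.meet_left intro: M.meet_leI1)
    qed (use c in auto)
  qed
  \<comment> \<open>As \<open>x (Suc l)\<close> is top, its image disappears from the left-hand
    side.\<close>
  from this[of l] have "p \<sqsubseteq>\<^bsub>M\<^esub> q"
    using hom[of l] x by (simp add: lattice_hom_def meet_comm[of M p])
  then show ?thesis
    by (simp add: lat_entails_def p_def q_def)
qed

section \<open>The canonical chain into \<open>Kr l T\<close> and its universality\<close>

context
  fixes T :: "'a gorder"
  assumes T: "bounded_distrib_lattice T"
begin

lemma bounded_distrib_lattice_Kr: "bounded_distrib_lattice (Kr l T)"
  unfolding Kr_def by (rule bounded_distrib_lattice_generated_lattice)

lemma Kr_entails:
  assumes "kr_entails l T A B"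
  shows "lat_entails (Kr l T) ((\<lambda>(i, x). kr_map l T i x) ` A) ((\<lambda>(i, x). kr_map l T i x) ` B)"
proof -
  have "(\<lambda>(i, x). kr_map l T i x) = (\<lambda>s. term_class (kr_gens l T) (kr_entails l T) (Gen s))"
    by (auto simp: kr_map_def)
  moreover have "finite A" "A \<subseteq> kr_gens l T" "finite B" "B \<subseteq> kr_gens l T"
    using assms by (simp_all add: kr_entails_def)
  ultimately show ?thesis
    using assms unfolding Kr_def by (simp add: generated_lattice_entails)
qed

lemma kr_map_closed: "i \<le> l \<Longrightarrow> a \<in> carrier T \<Longrightarrow> kr_map l T i a \<in> carrier (Kr l T)"
  by (simp add: kr_map_def Kr_def kr_gens_def)

text \<open>Each canonical map preserves entailment by \<open>kr_entails_Pair\<close> and is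
  therefore a homomorphism; \<open>kr_entails_Suc\<close> orders consecutive ones.\<close>

lemma hom_chain_kr_map: "hom_chain l T (Kr l T) (kr_map l T)"
  unfolding hom_chain_def hom_le_def
proof (intro conjI allI impI ballI)
  fix i
  assume i: "i \<le> l"
  show "kr_map l T i \<in> lattice_hom T (Kr l T)"
  proof (rule lattice_hom_if_lat_entails)
    fix A B
    assume "finite A" "A \<subseteq> carrier T" "finite B" "B \<subseteq> carrier T" "lat_entails T A B"
    then show "lat_entails (Kr l T) (kr_map l T i ` A) (kr_map l T i ` B)"
      using Kr_entails[OF kr_entails_Pair[OF T i]] by (simp add: image_image)
  qed (use T i bounded_distrib_lattice_Kr kr_map_closed in auto)
next
  fix i a
  assume ia: "i < l" "a \<in> carrier T"
  interpret K: bounded_distrib_lattice "Kr l T"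
    by (rule bounded_distrib_lattice_Kr)
  show "kr_map l T (Suc i) a \<sqsubseteq>\<^bsub>Kr l T\<^esub> kr_map l T i a"
    using Kr_entails[OF kr_entails_Suc[OF T ia]] ia by (simp add: lat_entails_def kr_map_closed)
qed

text \<open>A chain amounts to an assignment of the generators \<open>(i, x)\<close> that respects
  the relations, so this is the universal property of the presentation rewritten by
  \<open>iff\<close>.\<close>

lemma universal_chain_Kr: "universal_chain TYPE('c) l T (Kr l T) (kr_map l T)"
  unfolding universal_chain_def
proof (intro conjI allI impI)
  fix M :: "'c gorder" and \<psi>
  assume M: "bounded_distrib_lattice M \<and> hom_chain l T M \<psi>"
  have "\<psi> i x \<in> carrier M" if "i \<le> l" "x \<in> carrier T" for i x
    using M that lattice_hom_closed[of "\<psi> i" T M] by (auto simp: hom_chain_def)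
  then have f: "(\<lambda>(i, x). \<psi> i x) \<in> kr_gens l T \<rightarrow> carrier M"
    by (auto simp: kr_gens_def)
  have iff: "(\<forall>s\<in>kr_gens l T.
      \<eta> (term_class (kr_gens l T) (kr_entails l T) (Gen s)) = (case s of (i, x) \<Rightarrow> \<psi> i x)) \<longleftrightarrow>
    (\<forall>i\<le>l. \<forall>x\<in>carrier T. \<eta> (kr_map l T i x) = \<psi> i x)" for \<eta>
    by (auto simp: kr_gens_def kr_map_def)
  show "\<exists>!\<eta>. \<eta> \<in> lattice_hom (Kr l T) M \<and> \<eta> \<in> extensional (carrier (Kr l T)) \<and>
      (\<forall>i\<le>l. \<forall>x\<in>carrier T. \<eta> (kr_map l T i x) = \<psi> i x)"
    using generated_lattice_universal[of M _ "kr_gens l T" "kr_entails l T", OF _ f] M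
      hom_chain_lat_entails[OF T]
    unfolding iff Kr_def by blast
qed (rule bounded_distrib_lattice_Kr hom_chain_kr_map)+

end

text \<open>Take \<open>K\<close> itself as test lattice: \<open>\<theta>\<close> and the identity,
  both restricted to the carrier to become extensional, solve the same problem and so
  coincide.\<close>

lemma universal_chain_endo:
  fixes K :: "'b gorder"
  assumes "universal_chain TYPE('b) l T K \<phi>"
    and "\<theta> \<in> lattice_hom K K" "\<And>i x. i \<le> l \<Longrightarrow> x \<in> carrier T \<Longrightarrow> \<theta> (\<phi> i x) = \<phi> i x"
    and "z \<in> carrier K"
  shows "\<theta> z = z"
proof -
  interpret K: bounded_distrib_lattice K
    using assms(1) by (simp add: universal_chain_def)
  have chain: "hom_chain l T K \<phi>"
    using assms(1) by (simp add: universal_chain_def)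
  then have cl: "\<phi> i x \<in> carrier K" if "i \<le> l" "x \<in> carrier T" for i x
    using that lattice_hom_closed[of "\<phi> i" T K] by (auto simp: hom_chain_def)
  have ex1: "\<exists>!\<eta>. \<eta> \<in> lattice_hom K K \<and> \<eta> \<in> extensional (carrier K) \<and>
      (\<forall>i\<le>l. \<forall>x\<in>carrier T. \<eta> (\<phi> i x) = \<phi> i x)"
    using assms(1) chain K.bounded_distrib_lattice_axioms by (simp add: universal_chain_def)
  have restr: "restrict f (carrier K) \<in> lattice_hom K K" if "f \<in> lattice_hom K K" for f
    using that by (auto simp: lattice_hom_def meet_pres_def join_pres_def)
  have "id \<in> lattice_hom K K"
    using K.lattice_axioms by (simp add: lattice_hom_def meet_pres_def join_pres_def)
  then have "restrict id (carrier K) \<in> lattice_hom K K"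
    by (rule restr)
  moreover have "restrict \<theta> (carrier K) \<in> lattice_hom K K"
    using assms(2) by (rule restr)
  moreover have "\<forall>i\<le>l. \<forall>x\<in>carrier T. restrict \<theta> (carrier K) (\<phi> i x) = \<phi> i x"
    "\<forall>i\<le>l. \<forall>x\<in>carrier T. restrict id (carrier K) (\<phi> i x) = \<phi> i x"
    using assms(3) cl by simp_all
  ultimately have "restrict \<theta> (carrier K) = restrict id (carrier K)"
    using ex1 restrict_extensional by blast
  then show ?thesis
    using assms(4) by (metis id_apply restrict_apply')
qed

text \<open>Universality against the type of the other lattice yields the two comparison maps;
  universality against the own type makes their composites identities by
  \<open>universal_chain_endo\<close>.\<close>

lemma universal_chain_iso:
  fixes K :: "'b gorder" and K' :: "'d gorder"
  assumes K: "universal_chain TYPE('b) l T K \<phi>" "universal_chain TYPE('d) l T K \<phi>"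
    and K': "universal_chain TYPE('d) l T K' \<phi>'" "universal_chain TYPE('b) l T K' \<phi>'"
  shows "\<exists>\<theta>\<in>lattice_iso K K'. \<forall>i\<le>l. \<forall>x\<in>carrier T. \<theta> (\<phi> i x) = \<phi>' i x"
proof -
  have bdl: "bounded_distrib_lattice K" "hom_chain l T K \<phi>"
    "bounded_distrib_lattice K'" "hom_chain l T K' \<phi>'"
    using K K' by (simp_all add: universal_chain_def)
  have cl: "\<phi> i x \<in> carrier K" "\<phi>' i x \<in> carrier K'" if "i \<le> l" "x \<in> carrier T" for i x
    using bdl that lattice_hom_closed[of "\<phi> i" T K] lattice_hom_closed[of "\<phi>' i" T K']
    by (auto simp: hom_chain_def)
  obtain \<theta> where \<theta>: "\<theta> \<in> lattice_hom K K'" "\<forall>i\<le>l. \<forall>x\<in>carrier T. \<theta> (\<phi> i x) = \<phi>' i x"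
    using K(2) bdl unfolding universal_chain_def by blast
  obtain \<theta>' where \<theta>': "\<theta>' \<in> lattice_hom K' K" "\<forall>i\<le>l. \<forall>x\<in>carrier T. \<theta>' (\<phi>' i x) = \<phi> i x"
    using K'(2) bdl unfolding universal_chain_def by blast
  have "\<theta>' (\<theta> z) = z" if "z \<in> carrier K" for z
    using universal_chain_endo[OF K(1) lattice_hom_compose[OF bdl(1) \<theta>(1) \<theta>'(1)] _ that]
      \<theta>(2) \<theta>'(2) cl that by (simp add: compose_def)
  moreover have "\<theta> (\<theta>' z) = z" if "z \<in> carrier K'" for z
    using universal_chain_endo[OF K'(1) lattice_hom_compose[OF bdl(3) \<theta>'(1) \<theta>(1)] _ that]
      \<theta>(2) \<theta>'(2) cl that by (simp add: compose_def)
  ultimately have "bij_betw \<theta> (carrier K) (carrier K')"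
    using lattice_hom_closed[OF \<theta>(1)] lattice_hom_closed[OF \<theta>'(1)]
    by (intro bij_betwI[of _ _ _ \<theta>']) auto
  then show ?thesis
    using \<theta> by (auto simp: lattice_iso_def)
qed

text \<open>The type variable \<open>'c\<close> is free, so universality of \<open>Kr l T\<close> is
  available against every type of test lattices. For uniqueness, the competitor \<open>K\<close> is
  tested against its own type and against that of \<open>Kr l T\<close>, as
  \<open>universal_chain_iso\<close> requires.\<close>

theorem theorem2p17:
  fixes T :: "'a gorder" and l :: nat
  assumes "bounded_distrib_lattice T"
  shows "entailment_relation (kr_gens l T) (kr_entails l T) \<and>
    universal_chain TYPE('c) l T (Kr l T) (kr_map l T) \<and>
    (\<forall>(K :: 'd gorder) \<phi>.
      universal_chain TYPE('d) l T K \<phi> \<and>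
      universal_chain TYPE((nat \<times> 'a) lat_term set) l T K \<phi> \<longrightarrow>
      (\<exists>\<theta> \<in> lattice_iso (Kr l T) K.
        \<forall>i\<le>l. \<forall>x\<in>carrier T. \<theta> (kr_map l T i x) = \<phi> i x))"
  using assms
  by (intro conjI allI impI)
    (auto intro!: entailment_relation_kr_entails universal_chain_Kr universal_chain_iso)

end
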